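(* Let $P$ be an ergodic Markov kernel on a finite set $\mathcal X$, reversible with respect to the strictly positive probability distribution $\pi$, and let $\mathcal O=\{O_1,\ldots,O_k\}$ be a partition of $\mathcal X$ into $k\in\{1,\ldots,n\}$ nonempty blocks, $n=|\mathcal X|$. Then $F(\mathcal O):=\|G_{\mathcal O}P-\Pi\|_{F,\pi}^2$ satisfies $$F(\mathcal O)=\operatorname{Tr}\bigl((G_{\mathcal O}-\Pi)P^2\bigr)=k-1-\operatorname{Ncut}_{P^2}(\mathcal O).$$
   Context: $\mathcal X$ is a finite set with $n=|\mathcal X|\ge 3$ and $\pi$ is a probability distribution on $\mathcal X$ with $\pi(x)>0$ for all $x$. $\ell^2(\pi)$ is the space of real functions on $\mathcal X$ with $\langle f,g\rangle_\pi=\sum_x\pi(x)f(x)g(x)$. Kernels act by $(Pf)(x)=\sum_yP(x,y)f(y)$. Ergodic means irreducible and aperiodic; reversible means $\pi(x)P(x,y)=\pi(y)P(y,x)$ for all $x,y$. $\Pi$ is the kernel $\Pi(x,y)=\pi(y)$. The Gibbs kernel of $\mathcal O$ is $G_{\mathcal O}(x,y)=\sum_{i=1}^k\mathbf 1_{O_i}(x)\mathbf 1_{O_i}(y)\pi(y)/\pi(O_i)$. For an operator $A$ on $\ell^2(\pi)$, $\|A\|_{F,\pi}^2=\operatorname{Tr}(A^*A)=\sum_{x,y}\frac{\pi(x)}{\pi(y)}A(x,y)^2$ ($A^*$ the adjoint in $\ell^2(\pi)$). For an entrywise nonnegative matrix $B$ and a partition $\mathcal O$, $\operatorname{Ncut}_B(\mathcal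 O)=\sum_{i=1}^k\frac{1}{\pi(O_i)}\sum_{x\in O_i}\sum_{y\in O_i^c}\pi(x)B(x,y)$. *)

theory Defs
  imports "HOL-Analysis.Analysis" "HOL-Library.Disjoint_Sets"
begin

text \<open>
  The state space is the finite type \<open>'n\<close>; kernels and operators on real functions are
  matrices \<open>A\<close> with entries \<open>A $ x $ y\<close>, acting by \<open>*v\<close> and composed by \<open>**\<close>.
\<close>

text \<open>The overloaded \<open>^\<close> must not be used here: on vectors it is the entrywise power.\<close>

definition kernel_power :: "real ^ 'n ^ 'n::finite \<Rightarrow> nat \<Rightarrow> real ^ 'n ^ 'n" where
  "kernel_power P t = ((**) P ^^ t) (mat 1)"

definition positive_distribution :: "real ^ 'n::finite \<Rightarrow> bool" where
  "positive_distribution \<pi> \<longleftrightarrow> (\<forall>x. 0 < \<pi> $ x) \<and> (\<Sum>x\<in>UNIV. \<pi> $ x) = 1"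

definition mass :: "real ^ 'n::finite \<Rightarrow> 'n set \<Rightarrow> real" where
  "mass \<pi> B = (\<Sum>x\<in>B. \<pi> $ x)"

definition markov_kernel :: "real ^ 'n ^ 'n::finite \<Rightarrow> bool" where
  "markov_kernel P \<longleftrightarrow> (\<forall>x y. 0 \<le> P $ x $ y) \<and> (\<forall>x. (\<Sum>y\<in>UNIV. P $ x $ y) = 1)"

definition irreducible_kernel :: "real ^ 'n ^ 'n::finite \<Rightarrow> bool" where
  "irreducible_kernel P \<longleftrightarrow> (\<forall>x y. \<exists>t. 0 < kernel_power P t $ x $ y)"

definition period :: "real ^ 'n ^ 'n::finite \<Rightarrow> 'n \<Rightarrow> nat" where
  "period P x = Gcd {t. 1 \<le> t \<and> 0 < kernel_power P t $ x $ x}"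

definition aperiodic_kernel :: "real ^ 'n ^ 'n::finite \<Rightarrow> bool" where
  "aperiodic_kernel P \<longleftrightarrow> (\<forall>x. period P x = 1)"

definition ergodic_kernel :: "real ^ 'n ^ 'n::finite \<Rightarrow> bool" where
  "ergodic_kernel P \<longleftrightarrow> irreducible_kernel P \<and> aperiodic_kernel P"

definition reversible_kernel :: "real ^ 'n::finite \<Rightarrow> real ^ 'n ^ 'n \<Rightarrow> bool" where
  "reversible_kernel \<pi> P \<longleftrightarrow> (\<forall>x y. \<pi> $ x * P $ x $ y = \<pi> $ y * P $ y $ x)"

definition stationary_kernel :: "real ^ 'n::finite \<Rightarrow> real ^ 'n ^ 'n" where
  "stationary_kernel \<pi> = (\<chi> x y. \<pi> $ y)"

definition gibbs_kernel :: "real ^ 'n::finite \<Rightarrow> 'n set set \<Rightarrow> real ^ 'n ^ 'n" where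
  "gibbs_kernel \<pi> \<O> =
     (\<chi> x y. \<Sum>B\<in>\<O>. indicator B x * indicator B y * \<pi> $ y / mass \<pi> B)"

definition ell2_inner :: "real ^ 'n::finite \<Rightarrow> real ^ 'n \<Rightarrow> real ^ 'n \<Rightarrow> real" where
  "ell2_inner \<pi> f g = (\<Sum>x\<in>UNIV. \<pi> $ x * f $ x * g $ x)"

text \<open>
  The library's \<open>adjoint\<close> refers to the unweighted inner product, so the adjoint in
  \<open>\<ell>\<^sup>2(\<pi>)\<close> is introduced separately. It exists and is unique when \<open>\<pi>\<close> is strictly positive.
\<close>

definition ell2_adjoint :: "real ^ 'n::finite \<Rightarrow> real ^ 'n ^ 'n \<Rightarrow> real ^ 'n ^ 'n" where
  "ell2_adjoint \<pi> A = (THE B. \<forall>f g. ell2_inner \<pi> (A *v f) g = ell2_inner \<pi> f (B *v g))"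

definition frobenius_norm :: "real ^ 'n::finite \<Rightarrow> real ^ 'n ^ 'n \<Rightarrow> real" where
  "frobenius_norm \<pi> A = sqrt (trace (ell2_adjoint \<pi> A ** A))"

definition Ncut :: "real ^ 'n::finite \<Rightarrow> real ^ 'n ^ 'n \<Rightarrow> 'n set set \<Rightarrow> real" where
  "Ncut \<pi> B \<O> = (\<Sum>S\<in>\<O>. 1 / mass \<pi> S * (\<Sum>x\<in>S. \<Sum>y\<in>-S. \<pi> $ x * B $ x $ y))"

lemma ell2_inner_axis:
  "ell2_inner \<pi> (A *v axis y 1) (axis x 1) = \<pi> $ x * A $ x $ y"
  "ell2_inner \<pi> (axis y 1) (B *v axis x 1) = \<pi> $ y * B $ y $ x"
  by (simp_all add: ell2_inner_def matrix_vector_mul_component inner_axis)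
     (simp_all add: axis_def if_distrib if_distribR cong: if_cong)

lemma ell2_adjoint_eq:
  assumes "positive_distribution \<pi>"
  shows "ell2_adjoint \<pi> A = (\<chi> x y. \<pi> $ y * A $ y $ x / \<pi> $ x)"
  unfolding ell2_adjoint_def
proof (rule the_equality)
  have pos: "\<pi> $ x \<noteq> 0" for x
    using assms unfolding positive_distribution_def by (metis less_irrefl)
  let ?B = "\<chi> x y. \<pi> $ y * A $ y $ x / \<pi> $ x"
  show "\<forall>f g. ell2_inner \<pi> (A *v f) g = ell2_inner \<pi> f (?B *v g)"
  proof (intro allI)
    fix f g
    have "ell2_inner \<pi> (A *v f) g = (\<Sum>x\<in>UNIV. \<Sum>y\<in>UNIV. \<pi> $ x * A $ x $ y * f $ y * g $ x)"
      by (simp add: ell2_inner_def matrix_vector_mult_def sum_distrib_left sum_distrib_right mult_ac)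
    also have "\<dots> = (\<Sum>y\<in>UNIV. \<Sum>x\<in>UNIV. \<pi> $ x * A $ x $ y * f $ y * g $ x)"
      by (rule sum.swap)
    also have "\<dots> = ell2_inner \<pi> f (?B *v g)"
      by (simp add: ell2_inner_def matrix_vector_mult_def sum_distrib_left sum_distrib_right pos mult_ac)
    finally show "ell2_inner \<pi> (A *v f) g = ell2_inner \<pi> f (?B *v g)" .
  qed
  fix B assume B: "\<forall>f g. ell2_inner \<pi> (A *v f) g = ell2_inner \<pi> f (B *v g)"
  have "\<pi> $ x * A $ x $ y = \<pi> $ y * B $ y $ x" for x y
    using B[rule_format, of "axis y 1" "axis x 1"] by (simp add: ell2_inner_axis)
  then show "B = ?B"
    by (simp add: vec_eq_iff pos field_simps)
qed

lemma frobenius_norm_sq: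
  assumes "positive_distribution \<pi>"
  shows "(frobenius_norm \<pi> A)\<^sup>2 = (\<Sum>x\<in>UNIV. \<Sum>y\<in>UNIV. \<pi> $ x / \<pi> $ y * (A $ x $ y)\<^sup>2)"
proof -
  have "trace (ell2_adjoint \<pi> A ** A) =
      (\<Sum>y\<in>UNIV. \<Sum>x\<in>UNIV. \<pi> $ x / \<pi> $ y * (A $ x $ y)\<^sup>2)"
    by (simp add: trace_def ell2_adjoint_eq[OF assms] matrix_matrix_mult_def power2_eq_square mult_ac)
  also have "\<dots> = (\<Sum>x\<in>UNIV. \<Sum>y\<in>UNIV. \<pi> $ x / \<pi> $ y * (A $ x $ y)\<^sup>2)"
    by (rule sum.swap)
  finally have *: "trace (ell2_adjoint \<pi> A ** A) =
      (\<Sum>x\<in>UNIV. \<Sum>y\<in>UNIV. \<pi> $ x / \<pi> $ y * (A $ x $ y)\<^sup>2)" .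
  have "0 \<le> \<pi> $ x" for x
    using assms unfolding positive_distribution_def by (metis less_imp_le)
  then show ?thesis
    unfolding frobenius_norm_def * by (intro real_sqrt_pow2 sum_nonneg mult_nonneg_nonneg) simp_all
qed

end

theory Submission
  imports Defs
begin

text \<open>
  Both \<open>G\<close> and \<open>\<Pi>\<close> are self-adjoint idempotents on \<open>\<ell>\<^sup>2(\<pi>)\<close>, and \<open>\<Pi>\<close> absorbs every
  \<open>\<pi>\<close>-reversible kernel from both sides. Hence \<open>(GP - \<Pi>)\<^sup>*(GP - \<Pi>) = PGP - \<Pi>\<close>, and cyclicity of the
  trace gives the first equality. The second one holds because the row sums of \<open>P\<^sup>2\<close> are 1, so each
  block contributes 1 minus its normalised outflow to \<open>Tr(G P\<^sup>2)\<close>.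
\<close>

lemma kernel_power_2: "kernel_power P 2 = P ** P"
  by (simp add: kernel_power_def numeral_2_eq_2)

lemma matrix_diff_ldistrib:
  fixes A :: "real ^ 'n ^ 'm" and B C :: "real ^ 'k ^ 'n"
  shows "A ** (B - C) = A ** B - A ** C"
  by (simp add: vec_eq_iff matrix_matrix_mult_def right_diff_distrib sum_subtractf)

lemma matrix_diff_rdistrib:
  fixes A B :: "real ^ 'n ^ 'm" and C :: "real ^ 'k ^ 'n"
  shows "(A - B) ** C = A ** C - B ** C"
  by (simp add: vec_eq_iff matrix_matrix_mult_def left_diff_distrib sum_subtractf)

text \<open>Undoing the square root needs a nonnegative trace; this comes from the weighted sum of
  squared entries, to which both sides are equal. The operator form on the right is the one suited
  to algebra with projections.\<close>

lemma frobenius_norm_sq_trace: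
  assumes "positive_distribution \<pi>"
  shows "(frobenius_norm \<pi> A)\<^sup>2 = trace (ell2_adjoint \<pi> A ** A)"
proof -
  have "trace (ell2_adjoint \<pi> A ** A) =
      (\<Sum>y\<in>UNIV. \<Sum>x\<in>UNIV. \<pi> $ x / \<pi> $ y * (A $ x $ y)\<^sup>2)"
    by (simp add: trace_def ell2_adjoint_eq[OF assms] matrix_matrix_mult_def power2_eq_square mult_ac)
  also have "\<dots> = (frobenius_norm \<pi> A)\<^sup>2"
    unfolding frobenius_norm_sq[OF assms] by (rule sum.swap)
  finally show ?thesis ..
qed

lemma ell2_adjoint_diff:
  assumes "positive_distribution \<pi>"
  shows "ell2_adjoint \<pi> (A - B) = ell2_adjoint \<pi> A - ell2_adjoint \<pi> B"
  by (simp add: ell2_adjoint_eq[OF assms] vec_eq_iff right_diff_distrib diff_divide_distrib)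

text \<open>In the entrywise formula for the right-hand side, the weight at the intermediate state
  occurs once as a factor and once as a divisor, so it cancels.\<close>

lemma ell2_adjoint_mult:
  assumes "positive_distribution \<pi>"
  shows "ell2_adjoint \<pi> (A ** B) = ell2_adjoint \<pi> B ** ell2_adjoint \<pi> A"
proof -
  have pos: "\<pi> $ x \<noteq> 0" for x
    using assms unfolding positive_distribution_def by (metis less_irrefl)
  show ?thesis
    by (simp add: ell2_adjoint_eq[OF assms] vec_eq_iff matrix_matrix_mult_def sum_distrib_left
        sum_divide_distrib pos mult_ac)
qed

text \<open>Detailed balance is exactly self-adjointness for the weighted inner product.\<close>

lemma ell2_adjoint_reversible:
  assumes "positive_distribution \<pi>" "reversible_kernel \<pi> A"
  shows "ell2_adjoint \<pi> A = A"
proof -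
  have pos: "\<pi> $ x \<noteq> 0" for x
    using assms(1) unfolding positive_distribution_def by (metis less_irrefl)
  have "\<pi> $ y * A $ y $ x = \<pi> $ x * A $ x $ y" for x y
    using assms(2) by (simp add: reversible_kernel_def)
  then show ?thesis
    by (simp add: ell2_adjoint_eq[OF assms(1)] vec_eq_iff pos)
qed

lemma reversible_stationary_kernel: "reversible_kernel \<pi> (stationary_kernel \<pi>)"
  by (simp add: reversible_kernel_def stationary_kernel_def mult.commute)

lemma reversible_gibbs_kernel: "reversible_kernel \<pi> (gibbs_kernel \<pi> \<O>)"
  by (simp add: reversible_kernel_def gibbs_kernel_def sum_distrib_left mult_ac)

lemma row_sum_mult:
  fixes A B :: "real ^ 'n ^ 'n::finite"
  assumes "\<And>x. (\<Sum>y\<in>UNIV. A $ x $ y) = 1" "\<And>x. (\<Sum>y\<in>UNIV. B $ x $ y) = 1"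
  shows "(\<Sum>y\<in>UNIV. (A ** B) $ x $ y) = 1"
proof -
  have "(\<Sum>y\<in>UNIV. (A ** B) $ x $ y) = (\<Sum>z\<in>UNIV. \<Sum>y\<in>UNIV. A $ x $ z * B $ z $ y)"
    unfolding matrix_matrix_mult_def by (simp, rule sum.swap)
  then show ?thesis
    by (simp add: assms flip: sum_distrib_left)
qed

text \<open>All rows of \<open>stationary_kernel \<pi>\<close> coincide, so averaging them with
  weights of total 1 changes nothing.\<close>

lemma mult_stationary_kernel:
  assumes "\<And>x. (\<Sum>y\<in>UNIV. A $ x $ y) = 1"
  shows "A ** stationary_kernel \<pi> = stationary_kernel \<pi>"
  by (simp add: vec_eq_iff matrix_matrix_mult_def stationary_kernel_def assms
      flip: sum_distrib_right)

text \<open>Detailed balance rewrites the column sum of \<open>\<pi> $ y * A $ y $ x\<close> over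
  \<open>y\<close> as \<open>\<pi> $ x\<close> times a row sum: reversibility makes
  \<open>\<pi>\<close> stationary.\<close>

lemma stationary_kernel_mult:
  assumes "\<And>x. (\<Sum>y\<in>UNIV. A $ x $ y) = 1" "reversible_kernel \<pi> A"
  shows "stationary_kernel \<pi> ** A = stationary_kernel \<pi>"
proof -
  have "\<pi> $ y * A $ y $ x = \<pi> $ x * A $ x $ y" for x y
    using assms(2) by (simp add: reversible_kernel_def)
  then show ?thesis
    by (simp add: vec_eq_iff matrix_matrix_mult_def stationary_kernel_def assms(1)
        flip: sum_distrib_left)
qed

lemma trace_stationary_kernel:
  assumes "positive_distribution \<pi>"
  shows "trace (stationary_kernel \<pi>) = 1"
  using assms by (simp add: trace_def stationary_kernel_def positive_distribution_def)

lemma mass_pos: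
  assumes "positive_distribution \<pi>" "B \<noteq> {}"
  shows "0 < mass \<pi> B"
  unfolding mass_def using assms by (intro sum_pos) (auto simp: positive_distribution_def)

text \<open>Blocks are disjoint, so only the one containing \<open>x\<close> survives in the
  defining sum. Row \<open>x\<close> is thus \<open>\<pi>\<close> conditioned on that block.\<close>

lemma gibbs_kernel_entry:
  assumes "partition_on UNIV \<O>" "B \<in> \<O>" "x \<in> B"
  shows "gibbs_kernel \<pi> \<O> $ x $ y = indicator B y * \<pi> $ y / mass \<pi> B"
proof -
  have "indicator C x = (if C = B then 1 else 0 :: real)" if "C \<in> \<O>" for C
    using assms that by (auto simp: indicator_def dest: partition_onD2 disjointD)
  then have "gibbs_kernel \<pi> \<O> $ x $ y =
      (\<Sum>C\<in>\<O>. if C = B then indicator C y * \<pi> $ y / mass \<pi> C else 0)"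
    unfolding gibbs_kernel_def vec_lambda_beta by (intro sum.cong) auto
  then show ?thesis
    using assms(2) by simp
qed

lemma sum_indicator_mass: "(\<Sum>y\<in>UNIV. indicator B y * \<pi> $ y) = mass \<pi> B"
  unfolding mass_def by (rule sum.mono_neutral_cong_right) auto

lemma row_sum_gibbs_kernel:
  assumes "positive_distribution \<pi>" "partition_on UNIV \<O>"
  shows "(\<Sum>y\<in>UNIV. gibbs_kernel \<pi> \<O> $ x $ y) = 1"
proof -
  obtain B where B: "B \<in> \<O>" "x \<in> B"
    using partition_onD1[OF assms(2)] by blast
  then have "mass \<pi> B \<noteq> 0"
    using mass_pos[OF assms(1), of B] by (metis empty_iff less_irrefl)
  then show ?thesis
    by (simp add: gibbs_kernel_entry[OF assms(2) B] sum_indicator_mass flip: sum_divide_distrib)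
qed

lemma gibbs_kernel_idem:
  assumes "positive_distribution \<pi>" "partition_on UNIV \<O>"
  shows "gibbs_kernel \<pi> \<O> ** gibbs_kernel \<pi> \<O> = gibbs_kernel \<pi> \<O>"
proof -
  let ?G = "gibbs_kernel \<pi> \<O>"
  have "(?G ** ?G) $ x $ z = ?G $ x $ z" for x z
  proof -
    obtain B where B: "B \<in> \<O>" "x \<in> B"
      using partition_onD1[OF assms(2)] by blast
    \<comment> \<open>For \<open>y\<close> in the block of \<open>x\<close> the rows at
      \<open>x\<close> and \<open>y\<close> agree; for any other \<open>y\<close> the first factor
      vanishes.\<close>
    have "?G $ x $ y * ?G $ y $ z = ?G $ x $ y * ?G $ x $ z" for y
      by (cases "y \<in> B") (simp_all add: gibbs_kernel_entry[OF assms(2) B(1)] B(2))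
    then have "(?G ** ?G) $ x $ z = (\<Sum>y\<in>UNIV. ?G $ x $ y * ?G $ x $ z)"
      by (simp only: matrix_matrix_mult_def vec_lambda_beta)
    then show ?thesis
      by (simp add: row_sum_gibbs_kernel[OF assms] flip: sum_distrib_right)
  qed
  then show ?thesis
    by (simp add: vec_eq_iff)
qed

lemma trace_gibbs_kernel_mult:
  assumes "positive_distribution \<pi>" "partition_on UNIV \<O>" "\<And>x. (\<Sum>y\<in>UNIV. Q $ x $ y) = 1"
  shows "trace (gibbs_kernel \<pi> \<O> ** Q) = real (card \<O>) - Ncut \<pi> Q \<O>"
proof -
  \<comment> \<open>Here \<open>y\<close> is the diagonal index of the trace and \<open>x\<close>
    the inner one, so the weight \<open>\<pi> $ x\<close> from the Gibbs kernel stands next to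
    \<open>Q $ x $ y\<close>, as in \<open>Ncut\<close>.\<close>
  let ?f = "\<lambda>B x y. indicator B x * indicator B y * \<pi> $ x * Q $ x $ y / mass \<pi> B"
  have "trace (gibbs_kernel \<pi> \<O> ** Q) = (\<Sum>y\<in>UNIV. \<Sum>x\<in>UNIV. \<Sum>B\<in>\<O>. ?f B x y)"
    by (simp add: trace_def matrix_matrix_mult_def gibbs_kernel_def sum_distrib_left
        sum_distrib_right mult_ac)
  also have "\<dots> = (\<Sum>x\<in>UNIV. \<Sum>y\<in>UNIV. \<Sum>B\<in>\<O>. ?f B x y)"
    by (rule sum.swap)
  also have "\<dots> = (\<Sum>x\<in>UNIV. \<Sum>B\<in>\<O>. \<Sum>y\<in>UNIV. ?f B x y)"
    by (intro sum.cong refl sum.swap)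
  also have "\<dots> = (\<Sum>B\<in>\<O>. \<Sum>x\<in>UNIV. \<Sum>y\<in>UNIV. ?f B x y)"
    by (rule sum.swap)
  also have "\<dots> = (\<Sum>B\<in>\<O>. 1 - 1 / mass \<pi> B * (\<Sum>x\<in>B. \<Sum>y\<in>-B. \<pi> $ x * Q $ x $ y))"
  proof (intro sum.cong refl)
    fix B assume "B \<in> \<O>"
    then have m: "mass \<pi> B \<noteq> 0"
      using mass_pos[OF assms(1), of B] partition_onD3[OF assms(2)] by (metis less_irrefl)
    have inner: "(\<Sum>y\<in>UNIV. ?f B x y) = indicator B x * (\<Sum>y\<in>B. \<pi> $ x * Q $ x $ y) / mass \<pi> B" for x
    proof -
      have "(\<Sum>y\<in>UNIV. ?f B x y) = (\<Sum>y\<in>B. ?f B x y)"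
        by (rule sum.mono_neutral_right) auto
      then show ?thesis
        by (simp add: sum_distrib_left sum_divide_distrib mult_ac)
    qed
    have "(\<Sum>x\<in>UNIV. \<Sum>y\<in>UNIV. ?f B x y) = (\<Sum>x\<in>B. \<Sum>y\<in>UNIV. ?f B x y)"
      by (rule sum.mono_neutral_right) auto
    also have "\<dots> = (\<Sum>x\<in>B. \<Sum>y\<in>B. \<pi> $ x * Q $ x $ y) / mass \<pi> B"
      unfolding inner by (simp add: sum_divide_distrib)
    \<comment> \<open>The unit row sums enter here, trading the flow that stays in \<open>B\<close>
      for the flow that leaves it.\<close>
    also have "(\<Sum>x\<in>B. \<Sum>y\<in>B. \<pi> $ x * Q $ x $ y) =
        (\<Sum>x\<in>B. \<pi> $ x - (\<Sum>y\<in>-B. \<pi> $ x * Q $ x $ y))"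
    proof (rule sum.cong[OF refl])
      fix x
      have "(\<Sum>y\<in>B. \<pi> $ x * Q $ x $ y) + (\<Sum>y\<in>-B. \<pi> $ x * Q $ x $ y) =
          (\<Sum>y\<in>UNIV. \<pi> $ x * Q $ x $ y)"
        by (subst sum.union_disjoint[symmetric]) auto
      also have "\<dots> = \<pi> $ x"
        by (simp add: assms(3) flip: sum_distrib_left)
      finally show "(\<Sum>y\<in>B. \<pi> $ x * Q $ x $ y) = \<pi> $ x - (\<Sum>y\<in>-B. \<pi> $ x * Q $ x $ y)"
        by simp
    qed
    also have "\<dots> = mass \<pi> B - (\<Sum>x\<in>B. \<Sum>y\<in>-B. \<pi> $ x * Q $ x $ y)"
      by (simp add: sum_subtractf mass_def)
    finally show "(\<Sum>x\<in>UNIV. \<Sum>y\<in>UNIV. ?f B x y) =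
        1 - 1 / mass \<pi> B * (\<Sum>x\<in>B. \<Sum>y\<in>-B. \<pi> $ x * Q $ x $ y)"
      using m by (simp add: diff_divide_distrib)
  qed
  finally show ?thesis
    by (simp add: sum_subtractf Ncut_def)
qed

theorem mainTheorem1:
  fixes \<pi> :: "real ^ 'n::finite"
    and P :: "real ^ 'n ^ 'n"
    and \<O> :: "'n set set"
    and k :: nat
  assumes "CARD('n) \<ge> 3"
    and "positive_distribution \<pi>"
    and "markov_kernel P"
    and "ergodic_kernel P"
    and "reversible_kernel \<pi> P"
    and "k \<in> {1..CARD('n)}"
    and "partition_on UNIV \<O>"
    and "card \<O> = k"
  shows "(frobenius_norm \<pi> (gibbs_kernel \<pi> \<O> ** P - stationary_kernel \<pi>))\<^sup>2 =
           trace ((gibbs_kernel \<pi> \<O> - stationary_kernel \<pi>) ** kernel_power P 2)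
       \<and> trace ((gibbs_kernel \<pi> \<O> - stationary_kernel \<pi>) ** kernel_power P 2) =
           real k - 1 - Ncut \<pi> (kernel_power P 2) \<O>"
proof -
  let ?G = "gibbs_kernel \<pi> \<O>" and ?S = "stationary_kernel \<pi>"
  note pos = assms(2) and rev = assms(5) and part = assms(7)
  have rowP: "(\<Sum>y\<in>UNIV. P $ x $ y) = 1" for x
    using assms(3) by (simp add: markov_kernel_def)
  note rowG = row_sum_gibbs_kernel[OF pos part]
  \<comment> \<open>All three kernels are self-adjoint, so the adjoint only reverses the
    product.\<close>
  have adj: "ell2_adjoint \<pi> (?G ** P - ?S) = P ** ?G - ?S"
    by (simp add: ell2_adjoint_diff ell2_adjoint_mult ell2_adjoint_reversible pos rev
        reversible_gibbs_kernel reversible_stationary_kernel)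
  have SP: "?S ** P = ?S" and SG: "?S ** ?G = ?S" and PS: "P ** ?S = ?S" and GS: "?G ** ?S = ?S"
    by (simp_all add: stationary_kernel_mult mult_stationary_kernel rowP rowG rev
        reversible_gibbs_kernel)
  have SS: "?S ** ?S = ?S"
    using pos by (intro mult_stationary_kernel)
      (simp add: stationary_kernel_def positive_distribution_def)
  \<comment> \<open>Every term containing \<open>?S\<close> collapses to \<open>?S\<close>; the
    signs -1, -1, +1 leave a single \<open>- ?S\<close>.\<close>
  have "(P ** ?G - ?S) ** (?G ** P - ?S) =
      P ** (?G ** ?G) ** P - P ** (?G ** ?S) - ?S ** ?G ** P + ?S ** ?S"
    by (simp add: matrix_diff_ldistrib matrix_diff_rdistrib matrix_mul_assoc)
  also have "\<dots> = P ** ?G ** P - ?S"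
    by (simp add: gibbs_kernel_idem[OF pos part] SP SG PS GS SS)
  finally have prod: "(P ** ?G - ?S) ** (?G ** P - ?S) = P ** ?G ** P - ?S" .
  \<comment> \<open>Cyclicity carries the left \<open>P\<close> to the right end, which produces the
    square of \<open>P\<close>.\<close>
  have "trace (P ** (?G ** P)) = trace (?G ** P ** P)"
    by (rule trace_mul_sym)
  then have F: "(frobenius_norm \<pi> (?G ** P - ?S))\<^sup>2 = trace (?G ** (P ** P)) - 1"
    by (simp add: frobenius_norm_sq_trace pos adj prod trace_sub trace_stationary_kernel
        matrix_mul_assoc)
  \<comment> \<open>Hence the subtracted trace is again that of \<open>?S\<close>, namely 1,
    matching \<open>F\<close>.\<close>
  have "?S ** (P ** P) = ?S"
    by (simp add: matrix_mul_assoc SP)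
  then have T: "trace ((?G - ?S) ** (P ** P)) = trace (?G ** (P ** P)) - 1"
    by (simp add: matrix_diff_rdistrib trace_sub trace_stationary_kernel pos)
  have "trace (?G ** (P ** P)) = real k - Ncut \<pi> (P ** P) \<O>"
    using trace_gibbs_kernel_mult[OF pos part row_sum_mult[OF rowP rowP]] assms(8) by simp
  then show ?thesis
    using F T by (simp add: kernel_power_2)
qed

end
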